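(* Let $A$ be an $n\times n$ matrix such that every geometric eigenspace of $A$ has dimension $1$. Let $\lambda_1,\dots,\lambda_s$ be the distinct eigenvalues of $A$ with algebraic multiplicities $m_1,\dots,m_s$. For each $h$ let $\mathbf v_h^1,\dots,\mathbf v_h^{m_h}$ be a basis of the generalized eigenspace of $\lambda_h$ with $A\mathbf v_h^1=\lambda_h\mathbf v_h^1$ and $A\mathbf v_h^i=\lambda_h\mathbf v_h^i+\mathbf v_h^{i-1}$ for $2\le i\le m_h$, let $\{\mathbf w_h^i\}$ be the dual basis of $\{\mathbf v_h^i\}$, and put $\phi_h^i(\mathbf x)=\langle \mathbf x,\mathbf w_h^i\rangle$. Then for every initial condition $\mathbf x_0$ and every $t\in\mathbb R$, the solution $\mathbf x(t)=U^t\mathbf x(\mathbf x_0)=\exp(At)\mathbf x_0$ of $\dot{\mathbf x}=A\mathbf x$ satisfies $$ U^t\mathbf x(\mathbf x_0)=\sum_{h=1}^s\left[e^{\lambda_h t}\Big(\sum_{k=1}^{m_h}\phi_h^k(\mathbf x_0)\,\mathbf v_h^k\Big)+\sum_{i=1}^{m_h-1}\frac{t^i}{i!}e^{\lambda_h t}\Big(\sum_{k=i+1}^{m_h}\phi_h^k(\mathbf x_0)\,\mathbf v_h^{k-i}\Big)\right]. $$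
   Context: The Koopman operator family of a flow $S^t$ acts on observables by $U^t g=g\circ S^t$; here $S^t\mathbf x_0=\exp(At)\mathbf x_0$ and $\mathbf x(\cdot)$ denotes the coordinate (identity) observable. $\langle\cdot,\cdot\rangle$ is the Hermitian inner product, linear in the first argument; duality means $\langle \mathbf v_h^i,\mathbf w_k^j\rangle=\delta_{hk}\delta_{ij}$. The functions $\phi_h^i$ are called (generalized) eigenfunctions of the Koopman operator at $\lambda_h$. *)

theory Defs
  imports "HOL-Analysis.Analysis" "HOL-Computational_Algebra.Polynomial"
begin

(* The library operations "*" and "^" on 'a ^ 'n ^ 'n are componentwise, so powers and the
   exponential have to be built from the matrix product "**". *)

primrec matrix_power :: "'a::semiring_1 ^ 'n ^ 'n \<Rightarrow> nat \<Rightarrow> 'a ^ 'n ^ 'n" where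
  "matrix_power A 0 = mat 1"
| "matrix_power A (Suc k) = A ** matrix_power A k"

definition matrix_exp :: "complex ^ 'n ^ 'n \<Rightarrow> complex ^ 'n ^ 'n" where
  "matrix_exp A = (\<Sum>k. (1 / fact k) *\<^sub>R matrix_power A k)"

definition eigenspace :: "'a::field ^ 'n ^ 'n \<Rightarrow> 'a \<Rightarrow> ('a ^ 'n) set" where
  "eigenspace A l = {v. A *v v = l *s v}"

definition eigenvalue :: "'a::field ^ 'n ^ 'n \<Rightarrow> 'a \<Rightarrow> bool" where
  "eigenvalue A l \<longleftrightarrow> (\<exists>v. v \<noteq> 0 \<and> A *v v = l *s v)"

definition gen_eigenspace :: "'a::field ^ 'n ^ 'n \<Rightarrow> 'a \<Rightarrow> ('a ^ 'n) set" where
  "gen_eigenspace A l = {v. \<exists>k. matrix_power (A - mat l) k *v v = 0}"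

definition char_poly :: "'a::field ^ 'n ^ 'n \<Rightarrow> 'a poly" where
  "char_poly A = det (mat [:0, 1:] - map_matrix (\<lambda>c. [:c:]) A)"

definition alg_mult :: "'a::field ^ 'n ^ 'n \<Rightarrow> 'a \<Rightarrow> nat" where
  "alg_mult A l = order l (char_poly A)"

definition basis_family :: "('i \<Rightarrow> 'a::field ^ 'n) \<Rightarrow> 'i set \<Rightarrow> ('a ^ 'n) set \<Rightarrow> bool" where
  "basis_family v I E \<longleftrightarrow> inj_on v I \<and> vec.independent (v ` I) \<and> vec.span (v ` I) = E"

(* The library's inner product on complex ^ 'n is real-valued; this is the Hermitian one,
   linear in the first argument. *)
definition hermitian_inner :: "complex ^ 'n \<Rightarrow> complex ^ 'n \<Rightarrow> complex" where
  "hermitian_inner x y = (\<Sum>i\<in>UNIV. x $ i * cnj (y $ i))"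

definition linear_flow :: "complex ^ 'n ^ 'n \<Rightarrow> real \<Rightarrow> complex ^ 'n \<Rightarrow> complex ^ 'n" where
  "linear_flow A t x = matrix_exp (t *\<^sub>R A) *v x"

definition koopman :: "(real \<Rightarrow> 'x \<Rightarrow> 'x) \<Rightarrow> real \<Rightarrow> ('x \<Rightarrow> 'y) \<Rightarrow> 'x \<Rightarrow> 'y" where
  "koopman S t g = g \<circ> S t"

definition solves_linear_ivp ::
  "complex ^ 'n ^ 'n \<Rightarrow> complex ^ 'n \<Rightarrow> (real \<Rightarrow> complex ^ 'n) \<Rightarrow> bool" where
  "solves_linear_ivp A x0 x \<longleftrightarrow>
     x 0 = x0 \<and> (\<forall>t. (x has_vector_derivative A *v x t) (at t))"

end

theory Submission imports Defs "HOL-Computational_Algebra.Fundamental_Theorem_Algebra"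
begin

text \<open>
  Duality turns the formula into a statement about the flow on each Jordan chain, once the
  generalized eigenspaces are known to span the whole space. On a chain,
  \<open>g\<^sub>k(t) = \<Sum>j<k. t^j / j! e^(\<lambda>t) v\<^sub>k\<^sub>-\<^sub>j\<close> satisfies \<open>g\<^sub>k' = \<lambda> g\<^sub>k + g\<^sub>k\<^sub>-\<^sub>1 = A g\<^sub>k\<close> with
  \<open>g\<^sub>k(0) = v\<^sub>k\<close>, so it is the flow by uniqueness of solutions.

  The span \<open>S\<close> of the generalized eigenspaces is everything because every \<open>x\<close> is annihilated by
  some nonzero \<open>p(A)\<close>, which splits into linear factors, and \<open>(A - a) x \<in> S\<close> implies \<open>x \<in> S\<close>:
  \<open>A - a\<close> maps each generalized eigenspace other than that of \<open>a\<close> onto itself, so some \<open>u \<in> S\<close> makes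
  \<open>(A - a) (x - u)\<close>, and hence \<open>x - u\<close>, a generalized eigenvector for \<open>a\<close>.
\<close>

section \<open>Generalized eigenspaces under shifts of the matrix\<close>

lemma mat_vector_mult: "mat c *v x = c *s (x :: 'a::comm_semiring_1 ^ 'n)"
  by (simp add: vec_eq_iff mat_def matrix_vector_mult_def if_distrib [of "\<lambda>a. a * _"] cong: if_cong)

text \<open>The defining recursion adds its factor on the outside; inductions on the annihilating
  exponent need that factor next to the vector.\<close>

lemma matrix_power_Suc_vector:
  "matrix_power A (Suc k) *v x = matrix_power A k *v (A *v (x :: 'a::comm_semiring_1 ^ 'n))"
  by (induction k arbitrary: x) (simp_all flip: matrix_vector_mul_assoc)

lemma matrix_power_vector_eq_0_mono:
  assumes "matrix_power A k *v x = (0 :: 'a::comm_semiring_1 ^ 'n)" and "k \<le> j"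
  shows "matrix_power A j *v x = 0"
  using assms(2,1) by (induction rule: dec_induct) (simp_all flip: matrix_vector_mul_assoc)

lemma subspace_gen_eigenspace: "vec.subspace (gen_eigenspace A l)"
proof (rule vec.subspaceI)
  fix x y assume "x \<in> gen_eigenspace A l" "y \<in> gen_eigenspace A l"
  then obtain j k where "matrix_power (A - mat l) j *v x = 0" "matrix_power (A - mat l) k *v y = 0"
    by (auto simp: gen_eigenspace_def)
  then have "matrix_power (A - mat l) (max j k) *v x = 0"
    "matrix_power (A - mat l) (max j k) *v y = 0"
    by (auto elim: matrix_power_vector_eq_0_mono)
  then show "x + y \<in> gen_eigenspace A l"
    unfolding gen_eigenspace_def by (auto simp: matrix_vector_right_distrib intro!: exI [of _ "max j k"])
qed (auto simp: gen_eigenspace_def vector_scalar_commute)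

text \<open>Applying \<open>A - l\<close> once changes the annihilating exponent by one, and
  membership does not depend on which exponent works. Exponent 0 may be raised to 1 because
  annihilation is monotone in the exponent.\<close>

lemma gen_eigenspace_shift_iff:
  "A *v x - l *s x \<in> gen_eigenspace A l \<longleftrightarrow> x \<in> gen_eigenspace A l"
proof -
  have shift: "matrix_power (A - mat l) (Suc k) *v x = matrix_power (A - mat l) k *v (A *v x - l *s x)" for k
    by (simp only: matrix_power_Suc_vector matrix_vector_mult_diff_rdistrib mat_vector_mult)
  have "(\<exists>k. matrix_power (A - mat l) k *v x = 0) \<longleftrightarrow>
      (\<exists>k. matrix_power (A - mat l) (Suc k) *v x = 0)"
    by (metis matrix_power_vector_eq_0_mono le_add2 plus_1_eq_Suc)
  then show ?thesis
    by (simp only: gen_eigenspace_def mem_Collect_eq shift)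
qed

text \<open>If \<open>A - l\<close> is injective, so are all its powers. Unions of generalized
  eigenspaces may therefore range over all scalars instead of the eigenvalues only.\<close>

lemma gen_eigenspace_trivial:
  assumes "\<not> eigenvalue A l" shows "gen_eigenspace A l = {0}"
proof -
  have "x = 0" if "matrix_power (A - mat l) k *v x = 0" for k x
    using that
  proof (induction k)
    case (Suc k)
    then have "A *v (matrix_power (A - mat l) k *v x) = l *s (matrix_power (A - mat l) k *v x)"
      by (simp add: matrix_vector_mult_diff_rdistrib mat_vector_mult flip: matrix_vector_mul_assoc)
    then have "matrix_power (A - mat l) k *v x = 0"
      using assms by (auto simp: eigenvalue_def)
    then show ?case by (rule Suc.IH)
  qed simp
  then show ?thesis by (auto simp: gen_eigenspace_def)
qed

text \<open>On this space \<open>A - a\<close> is the nonzero scalar \<open>l - a\<close> plus the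
  locally nilpotent operator \<open>A - l\<close>, hence invertible. Induction on the exponent
  annihilating \<open>z\<close> replaces the finite geometric series for the inverse.\<close>

lemma gen_eigenspace_shift_surj:
  assumes "z \<in> gen_eigenspace A l" and "l \<noteq> a"
  obtains u where "u \<in> gen_eigenspace A l" and "A *v u - a *s u = z"
proof -
  have "\<exists>u \<in> gen_eigenspace A l. A *v u - a *s u = z" if "matrix_power (A - mat l) k *v z = 0" for k
    using that
  proof (induction k arbitrary: z)
    case 0
    then show ?case by (intro bexI [of _ 0]) (auto simp: gen_eigenspace_def)
  next
    case (Suc k)
    have "matrix_power (A - mat l) k *v (A *v z - l *s z) = 0"
      using Suc.prems unfolding matrix_power_Suc_vector
      by (simp add: matrix_vector_mult_diff_rdistrib mat_vector_mult)
    from Suc.IH [OF this] obtain u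
      where u: "u \<in> gen_eigenspace A l" "A *v u - a *s u = A *v z - l *s z" by blast
    have z: "z \<in> gen_eigenspace A l" using Suc.prems unfolding gen_eigenspace_def by blast
    \<comment> \<open>Since \<open>(A - a) u = (A - l) z\<close>, the vector \<open>u - z\<close> is
      mapped by \<open>A - a\<close> to \<open>(a - l) z\<close>; rescaling by \<open>c\<close>
      gives a preimage of \<open>z\<close>.\<close>
    define c where "c = inverse (a - l)"
    have "A *v (c *s (u - z)) - a *s (c *s (u - z))
        = c *s ((A *v u - a *s u) - (A *v z - a *s z))"
      by (simp add: vec.scale algebra_simps vec_eq_iff)
    also have "\<dots> = c *s ((a - l) *s z)"
      by (simp add: u vec_eq_iff algebra_simps)
    also have "\<dots> = z" using \<open>l \<noteq> a\<close>
      by (simp add: c_def vector_smult_assoc del: vector_sub_rdistrib vec.scale_left_diff_distrib)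
    finally show ?case
      using u z subspace_gen_eigenspace
      by (intro bexI [of _ "c *s (u - z)"]) (auto intro: vec.subspace_diff vec.subspace_scale)
  qed
  then show ?thesis using assms that by (auto simp: gen_eigenspace_def)
qed

section \<open>Polynomials in the matrix and the span of the generalized eigenspaces\<close>

text \<open>This is p(A) x in Horner form, computed on the vector without forming the matrix
  p(A).\<close>

definition poly_act :: "'a::field ^ 'n ^ 'n \<Rightarrow> 'a poly \<Rightarrow> 'a ^ 'n \<Rightarrow> 'a ^ 'n" where
  "poly_act A p x = fold_coeffs (\<lambda>c y. c *s x + A *v y) p 0"

lemma poly_act_0 [simp]: "poly_act A 0 x = 0"
  by (simp add: poly_act_def)

lemma poly_act_pCons [simp]: "poly_act A (pCons c p) x = c *s x + A *v poly_act A p x"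
  by (cases "c = 0 \<and> p = 0") (auto simp: poly_act_def)

lemma poly_act_add: "poly_act A (p + q) x = poly_act A p x + poly_act A q x"
  by (induction p q rule: poly_induct2)
    (simp_all add: matrix_vector_right_distrib vector_sadd_rdistrib algebra_simps)

lemma poly_act_smult: "poly_act A (smult c p) x = c *s poly_act A p x"
  by (induction p) (simp_all add: vector_add_ldistrib vector_smult_assoc vector_scalar_commute)

lemma poly_act_linear_factor:
  "poly_act A ([:- a, 1:] * p) x = A *v poly_act A p x - a *s poly_act A p x"
proof -
  have "[:- a, 1:] * p = pCons 0 p + smult (- a) p" by simp
  then show ?thesis by (simp only: poly_act_add poly_act_smult poly_act_pCons) (simp add: vec_eq_iff)
qed

lemma poly_act_monom: "poly_act A (monom c k) x = c *s (matrix_power A k *v x)"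
  by (induction k) (simp_all add: monom_0 monom_Suc vector_scalar_commute flip: matrix_vector_mul_assoc)

lemma poly_act_sum: "poly_act A (\<Sum>i\<in>I. f i) x = (\<Sum>i\<in>I. poly_act A (f i) x)"
  by (induction I rule: infinite_finite_induct) (simp_all add: poly_act_add)

text \<open>The n + 1 vectors x, A x, ..., A^n x in an n-dimensional space satisfy a nontrivial
  linear relation, whose coefficients form p. The polynomial may depend on x.\<close>

lemma annihilating_poly:
  obtains p where "p \<noteq> 0" and "poly_act A p (x :: 'a::field ^ 'n) = 0"
proof -
  define I where "I = {..CARD('n)}"
  define u where "u i = matrix_power A i *v x" for i
  have "\<exists>c. (\<exists>i\<in>I. c i \<noteq> 0) \<and> (\<Sum>i\<in>I. c i *s u i) = 0"
  \<comment> \<open>Dependence is a property of the image set, so it yields a relation between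
    indices only when \<open>u\<close> is injective. Otherwise a repetition \<open>u i = u j\<close>
    is itself a relation, with coefficients 1 and -1.\<close>
  proof (cases "inj_on u I")
    case True
    have "\<not> vec.independent (u ` I)"
    proof
      assume "vec.independent (u ` I)"
      then have "card (u ` I) \<le> CARD('n)"
        using vec.independent_card_le_dim [OF subset_UNIV] by (metis vec_dim_card)
      then show False using True by (simp add: card_image I_def)
    qed
    then obtain c where c: "\<exists>v\<in>u ` I. c v \<noteq> 0" "(\<Sum>v\<in>u ` I. c v *s v) = 0"
      by (auto simp: vec.dependent_finite I_def)
    with True show ?thesis
      by (intro exI [of _ "c \<circ> u"]) (auto simp: sum.reindex)
  next
    case False
    then obtain i j where "i \<in> I" "j \<in> I" "i \<noteq> j" "u i = u j" by (auto simp: inj_on_def)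
    then show ?thesis
      by (intro exI [of _ "\<lambda>k. if k = i then 1 else if k = j then -1 else 0"])
        (auto simp: I_def if_distrib [of "\<lambda>c. c *s _"] sum.If_cases Int_insert_right cong: if_cong)
  qed
  then obtain c where c: "\<exists>i\<in>I. c i \<noteq> 0" "(\<Sum>i\<in>I. c i *s u i) = 0" by blast
  define p where "p = (\<Sum>i\<in>I. monom (c i) i)"
  have "coeff p i = c i" if "i \<in> I" for i
    using that by (simp add: p_def coeff_sum I_def)
  with c(1) have "p \<noteq> 0" by auto
  moreover have "poly_act A p x = 0"
    using c(2) by (simp add: p_def poly_act_sum poly_act_monom u_def)
  ultimately show ?thesis by (rule that)
qed

lemma span_gen_eigenspaces_shift_reflect:
  fixes A :: "'a::field ^ 'n ^ 'n"
  defines "S \<equiv> vec.span (\<Union>l. gen_eigenspace A l)"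
  assumes "A *v x - a *s x \<in> S"
  shows "x \<in> S"
proof -
  \<comment> \<open>Modulo the generalized eigenspace of \<open>a\<close>, the map
    \<open>A - a\<close> sends \<open>S\<close> onto \<open>S\<close>: a summand belonging to
    \<open>a\<close> is absorbed with preimage 0, any other has an exact preimage.\<close>
  have "\<exists>u\<in>S. y - (A *v u - a *s u) \<in> gen_eigenspace A a" if "y \<in> S" for y
    using that unfolding S_def
  proof (induction rule: vec.span_induct_alt)
    case base
    show ?case by (intro bexI [of _ 0]) (auto simp: vec.span_zero gen_eigenspace_def)
  next
    case (step c z y)
    then obtain l where l: "z \<in> gen_eigenspace A l" by auto
    have G: "gen_eigenspace A l \<subseteq> vec.span (\<Union>l. gen_eigenspace A l)" for l
      by (auto intro: vec.span_base)
    have "\<exists>w\<in>vec.span (\<Union>l. gen_eigenspace A l). z - (A *v w - a *s w) \<in> gen_eigenspace A a"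
    proof (cases "l = a")
      case True
      with l show ?thesis by (intro bexI [of _ 0]) (auto simp: vec.span_zero)
    next
      case False
      from l False obtain w where "w \<in> gen_eigenspace A l" "A *v w - a *s w = z"
        by (rule gen_eigenspace_shift_surj)
      then show ?thesis using G by (intro bexI [of _ w]) (auto simp: gen_eigenspace_def)
    qed
    then obtain w where w: "w \<in> vec.span (\<Union>l. gen_eigenspace A l)"
      "z - (A *v w - a *s w) \<in> gen_eigenspace A a" by blast
    from step obtain u where u: "u \<in> vec.span (\<Union>l. gen_eigenspace A l)"
      "y - (A *v u - a *s u) \<in> gen_eigenspace A a" by blast
    have "c *s z + y - (A *v (c *s w + u) - a *s (c *s w + u))
        = c *s (z - (A *v w - a *s w)) + (y - (A *v u - a *s u))"
      by (simp add: matrix_vector_right_distrib vector_scalar_commute vec_eq_iff algebra_simps)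
    also have "\<dots> \<in> gen_eigenspace A a"
      by (intro vec.subspace_add vec.subspace_scale subspace_gen_eigenspace u w)
    finally show ?case
      using u w by (intro bexI [of _ "c *s w + u"]) (auto intro: vec.span_add vec.span_scale)
  qed
  then obtain u where u: "u \<in> S" "A *v x - a *s x - (A *v u - a *s u) \<in> gen_eigenspace A a"
    using assms by blast
  have "A *v x - a *s x - (A *v u - a *s u) = A *v (x - u) - a *s (x - u)"
    by (simp add: matrix_vector_mult_diff_distrib vector_ssub_ldistrib)
  with u(2) have "x - u \<in> gen_eigenspace A a"
    by (simp only: gen_eigenspace_shift_iff)
  then have "x - u \<in> S" by (auto simp: S_def intro: vec.span_base)
  with u(1) show ?thesis
    unfolding S_def by (metis vec.span_add diff_add_cancel)
qed

lemma span_gen_eigenspaces: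
  fixes A :: "'a::alg_closed_field ^ 'n ^ 'n"
  shows "vec.span (\<Union>l. gen_eigenspace A l) = UNIV"
proof -
  define S where "S = vec.span (\<Union>l. gen_eigenspace A l)"
  have "x \<in> S" for x
  proof -
    \<comment> \<open>Weakening p(A) x = 0 to membership in \<open>S\<close> lets the induction
      strip one linear factor at a time, down to a nonzero constant.\<close>
    have descent: "x \<in> S" if "p \<noteq> 0" "poly_act A p x \<in> S" for p
      using that
    proof (induction "degree p" arbitrary: p)
      case 0
      then obtain c where "p = [:c:]" "c \<noteq> 0" by (metis degree_eq_zeroE pCons_0_0)
      with 0 have "c *s x \<in> S" by simp
      then have "inverse c *s (c *s x) \<in> S" unfolding S_def by (rule vec.span_scale)
      with \<open>c \<noteq> 0\<close> show ?case by (simp add: vector_smult_assoc)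
    next
      case (Suc n)
      then obtain a where "poly p a = 0" using alg_closed_imp_poly_has_root [of p] by auto
      then obtain q where q: "p = [:- a, 1:] * q" by (auto simp: poly_eq_0_iff_dvd elim: dvdE)
      with Suc.prems have "q \<noteq> 0" by auto
      moreover from this have "n = degree q"
        using q Suc.hyps(2) degree_mult_eq [of "[:- a, 1:]" q] by (simp del: mult_pCons_left)
      moreover have "poly_act A q x \<in> S"
        using Suc.prems unfolding q poly_act_linear_factor S_def
        by (blast intro: span_gen_eigenspaces_shift_reflect)
      ultimately show ?case using Suc.hyps by blast
    qed
    obtain p where "p \<noteq> 0" "poly_act A p x = 0" by (rule annihilating_poly)
    then show ?thesis by (intro descent [of p]) (simp_all add: S_def vec.span_zero)
  qed
  then show ?thesis unfolding S_def by blast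
qed

section \<open>The matrix exponential and the derivative of the flow\<close>

text \<open>The bound \<open>K\<close> plays the part of a submultiplicative matrix norm. It serves
  both for left multiplication on matrices, where it makes the exponential series converge, and for
  the action of \<open>A\<close> on vectors.\<close>

lemma funpow_norm_bound:
  fixes f :: "'a::real_normed_vector \<Rightarrow> 'a"
  assumes "bounded_linear f"
  obtains K where "K \<ge> 0" and "\<And>k x. norm ((f ^^ k) x) \<le> K ^ k * norm x"
proof -
  obtain K where K: "K \<ge> 0" "\<And>x. norm (f x) \<le> norm x * K"
    using bounded_linear.nonneg_bounded [OF assms] by blast
  have "norm ((f ^^ k) x) \<le> K ^ k * norm x" for k x
  proof (induction k)
    case (Suc k)
    have "norm ((f ^^ Suc k) x) \<le> norm ((f ^^ k) x) * K" by (simp add: K(2))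
    also have "\<dots> \<le> K ^ k * norm x * K" using Suc.IH K(1) by (rule mult_right_mono)
    finally show ?case by (simp add: mult_ac)
  qed simp
  with K(1) show ?thesis by (rule that)
qed

lemma matrix_power_scaleR:
  "matrix_power (c *\<^sub>R A) k = c ^ k *\<^sub>R matrix_power (A :: 'a::real_algebra_1 ^ 'n ^ 'n) k"
  by (induction k) (simp_all add: vec_eq_iff matrix_matrix_mult_def scaleR_sum_right mult_ac)

lemma bounded_linear_matrix_mult:
  "bounded_linear (\<lambda>B. A ** B)" for A :: "complex ^ 'n ^ 'n"
  by (auto simp flip: linear_conv_bounded_linear
      intro!: linearI simp: vec_eq_iff matrix_matrix_mult_def scaleR_sum_right distrib_left sum.distrib)

lemma bounded_linear_matrix_vector_mult_left:
  "bounded_linear (\<lambda>M. M *v x)" for x :: "complex ^ 'n"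
  by (auto simp flip: linear_conv_bounded_linear
      intro!: linearI simp: vec_eq_iff matrix_vector_mult_def scaleR_sum_right distrib_right sum.distrib)

lemma summable_matrix_exp:
  "summable (\<lambda>k. (1 / fact k) *\<^sub>R matrix_power A k)" for A :: "complex ^ 'n ^ 'n"
proof -
  obtain K where K: "\<And>k B. norm (((\<lambda>B. A ** B) ^^ k) B) \<le> K ^ k * norm (B :: complex ^ 'n ^ 'n)"
    using funpow_norm_bound [OF bounded_linear_matrix_mult] by metis
  have "matrix_power A k = ((\<lambda>B. A ** B) ^^ k) (mat 1)" for k
    by (induction k) simp_all
  with K [of _ "mat 1"] have "norm (matrix_power A k) \<le> K ^ k * norm (mat 1 :: complex ^ 'n ^ 'n)" for k
    by simp
  then have "norm ((1 / fact k) *\<^sub>R matrix_power A k)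
      \<le> norm (mat 1 :: complex ^ 'n ^ 'n) * (inverse (fact k) * K ^ k)" for k
    by (simp add: divide_simps mult_ac)
  with summable_mult [OF summable_exp] show ?thesis by (rule summable_comparison_test')
qed

lemma linear_flow_sums:
  "(\<lambda>k. (t ^ k / fact k) *\<^sub>R (matrix_power A k *v x)) sums linear_flow A t x"
proof -
  have "(\<lambda>k. ((1 / fact k) *\<^sub>R matrix_power (t *\<^sub>R A) k) *v x) sums linear_flow A t x"
    unfolding linear_flow_def matrix_exp_def
    by (intro bounded_linear.sums [OF bounded_linear_matrix_vector_mult_left]
        summable_sums summable_matrix_exp)
  then show ?thesis
    by (simp add: matrix_power_scaleR
        linear_scale [OF bounded_linear.linear [OF bounded_linear_matrix_vector_mult_left]])
qed

lemma has_vector_derivative_componentwise_vec: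
  fixes f :: "real \<Rightarrow> 'a::euclidean_space ^ 'n"
  assumes "\<And>i. ((\<lambda>t. f t $ i) has_vector_derivative D $ i) F"
  shows "(f has_vector_derivative D) F"
proof -
  have blin: "bounded_linear (axis i :: 'a \<Rightarrow> 'a ^ 'n)" for i
    by (auto simp flip: linear_conv_bounded_linear intro!: linearI simp: vec_eq_iff axis_def)
  have decomp: "x = (\<Sum>i\<in>UNIV. axis i (x $ i))" for x :: "'a ^ 'n"
    by (simp add: vec_eq_iff axis_def)
  have "((\<lambda>t. \<Sum>i\<in>UNIV. axis i (f t $ i)) has_vector_derivative (\<Sum>i\<in>UNIV. axis i (D $ i))) F"
    by (intro has_vector_derivative_sum bounded_linear.has_vector_derivative [OF blin] assms)
  then show ?thesis by (simp only: decomp [symmetric])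
qed

text \<open>Each coordinate of the flow is an everywhere convergent complex power series restricted
  to real time, so it can be differentiated term by term.\<close>

lemma linear_flow_has_vector_derivative:
  "((\<lambda>t. linear_flow A t x) has_vector_derivative A *v linear_flow A t x) (at t)"
proof (rule has_vector_derivative_componentwise_vec)
  fix i
  \<comment> \<open>These are the Taylor coefficients of coordinate \<open>i\<close> of the flow
    started at \<open>y\<close>. The start stays variable because differentiation replaces
    \<open>x\<close> by \<open>A *v x\<close>.\<close>
  define c where "c y k = (matrix_power A k *v y) $ i / fact k" for y k
  obtain K where K: "K \<ge> 0" "\<And>k y. norm (((\<lambda>y. A *v y) ^^ k) y) \<le> K ^ k * norm y"
    using funpow_norm_bound [OF matrix_vector_mul_bounded_linear] by metis
  have "matrix_power A k *v y = ((\<lambda>y. A *v y) ^^ k) y" for k y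
    by (induction k) (simp_all flip: matrix_vector_mul_assoc)
  with K have coeff_bound: "norm ((matrix_power A k *v y) $ i) \<le> K ^ k * norm y" for k y
    using order_trans [OF Finite_Cartesian_Product.norm_nth_le K(2)] by simp
  have bound: "norm (c y k * z ^ k) \<le> norm y * (inverse (fact k) * (K * norm z) ^ k)" for y k z
  proof -
    have "norm (c y k * z ^ k) = norm ((matrix_power A k *v y) $ i) * (norm z ^ k / fact k)"
      by (simp add: c_def norm_mult norm_divide norm_power)
    also have "\<dots> \<le> (K ^ k * norm y) * (norm z ^ k / fact k)"
      using coeff_bound by (rule mult_right_mono) simp
    finally show ?thesis by (simp add: power_mult_distrib divide_inverse mult_ac)
  qed
  have summable: "summable (\<lambda>k. c y k * z ^ k)" for y z
    using summable_mult [OF summable_exp] bound by (rule summable_comparison_test')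
  have flow: "linear_flow A \<tau> y $ i = (\<Sum>k. c y k * of_real \<tau> ^ k)" for \<tau> y
  proof -
    have "(\<lambda>k. ((\<tau> ^ k / fact k) *\<^sub>R (matrix_power A k *v y)) $ i) sums (linear_flow A \<tau> y $ i)"
      by (intro bounded_linear.sums [OF bounded_linear_vec_nth] linear_flow_sums)
    then have "(\<lambda>k. c y k * of_real \<tau> ^ k) sums (linear_flow A \<tau> y $ i)"
      unfolding vector_scaleR_component unfolding scaleR_conv_of_real by (simp add: c_def mult_ac)
    then show ?thesis by (rule sums_unique)
  qed
  \<comment> \<open>The factor k + 1 from differentiation cancels against the factorial, and the
    surplus power of \<open>A\<close> moves onto \<open>x\<close>.\<close>
  have "diffs (c x) = c (A *v x)"
    by (simp add: diffs_def c_def fun_eq_iff matrix_power_Suc_vector divide_simps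
        del: matrix_power.simps of_nat_Suc)
  then have "((\<lambda>z. \<Sum>k. c x k * z ^ k) has_field_derivative (\<Sum>k. c (A *v x) k * of_real t ^ k))
      (at (of_real t))"
    using termdiffs_strong_converges_everywhere [OF summable, of x "of_real t"] by simp
  then have "((\<lambda>\<tau>. linear_flow A \<tau> x $ i) has_vector_derivative linear_flow A t (A *v x) $ i) (at t)"
    unfolding flow by (rule has_vector_derivative_real_field)
  \<comment> \<open>The derivative appears as the flow started at \<open>A *v x\<close>; passing
    \<open>A\<close> through the series brings it to the form of the equation.\<close>
  moreover have "linear_flow A t (A *v x) = A *v linear_flow A t x"
  proof -
    have "(\<lambda>k. A *v ((t ^ k / fact k) *\<^sub>R (matrix_power A k *v x))) sums (A *v linear_flow A t x)"
      by (intro bounded_linear.sums [OF matrix_vector_mul_bounded_linear] linear_flow_sums)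
    moreover have "A *v ((t ^ k / fact k) *\<^sub>R (matrix_power A k *v x))
        = (t ^ k / fact k) *\<^sub>R (matrix_power A k *v (A *v x))" for k
      using matrix_power_Suc_vector [of A k x]
      by (simp add: linear_scale [OF bounded_linear.linear [OF matrix_vector_mul_bounded_linear]]
          matrix_vector_mul_assoc)
    ultimately show ?thesis
      using linear_flow_sums [of t A "A *v x"] by (simp add: sums_unique2)
  qed
  ultimately show "((\<lambda>\<tau>. linear_flow A \<tau> x $ i) has_vector_derivative (A *v linear_flow A t x) $ i) (at t)"
    by simp
qed

lemma linear_flow_0: "linear_flow A 0 x = x"
proof -
  have "(\<lambda>k. (0 ^ k / fact k) *\<^sub>R (matrix_power A k *v x)) sums (\<Sum>k\<in>{0}. (0 ^ k / fact k) *\<^sub>R (matrix_power A k *v x))"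
    by (rule sums_finite) auto
  with linear_flow_sums [of 0 A x] show ?thesis by (simp add: sums_unique2)
qed

section \<open>Uniqueness of solutions of linear differential equations\<close>

lemma linear_ode_zero_forward:
  fixes d :: "real \<Rightarrow> 'a::real_inner"
  assumes "bounded_linear f"
    and der: "\<And>\<tau>. (d has_vector_derivative f (d \<tau>)) (at \<tau>)"
    and "d 0 = 0" and "t \<ge> 0"
  shows "d t = 0"
proof -
  obtain K where K: "\<And>x. norm (f x) \<le> norm x * K"
    using bounded_linear.bounded [OF assms(1)] by blast
  \<comment> \<open>Gronwall: the damped energy is nonincreasing.\<close>
  define E where "E \<tau> = (d \<tau> \<bullet> d \<tau>) * exp (- 2 * K * \<tau>)" for \<tau>
  have dE: "(E has_real_derivative (2 * (d \<tau> \<bullet> f (d \<tau>)) - 2 * K * (d \<tau> \<bullet> d \<tau>)) * exp (- 2 * K * \<tau>)) (at \<tau>)" for \<tau>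
  proof -
    have "((\<lambda>\<tau>. d \<tau> \<bullet> d \<tau>) has_real_derivative 2 * (d \<tau> \<bullet> f (d \<tau>))) (at \<tau>)"
      using has_derivative_inner [OF der [of \<tau>, unfolded has_vector_derivative_def]
          der [of \<tau>, unfolded has_vector_derivative_def]]
      by (auto simp: has_field_derivative_def inner_commute algebra_simps elim!: has_derivative_eq_rhs)
    then show ?thesis
      unfolding E_def by (auto intro!: derivative_eq_intros simp: algebra_simps)
  qed
  have "E t \<le> E 0"
  proof (rule DERIV_nonpos_imp_nonincreasing [OF \<open>t \<ge> 0\<close>])
    fix \<tau>
    have "d \<tau> \<bullet> f (d \<tau>) \<le> norm (d \<tau>) * norm (f (d \<tau>))" by (rule norm_cauchy_schwarz)
    also have "\<dots> \<le> norm (d \<tau>) * (norm (d \<tau>) * K)" by (intro mult_left_mono K) simp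
    finally have "d \<tau> \<bullet> f (d \<tau>) \<le> K * (d \<tau> \<bullet> d \<tau>)"
      by (simp add: dot_square_norm power2_eq_square mult_ac)
    then show "\<exists>y. (E has_real_derivative y) (at \<tau>) \<and> y \<le> 0"
      using dE [of \<tau>] by (intro exI conjI) (auto simp: mult_le_0_iff)
  qed
  then have "d t \<bullet> d t \<le> 0"
    using \<open>d 0 = 0\<close> by (simp add: E_def mult_le_0_iff)
  then show ?thesis by (metis inner_eq_zero_iff inner_ge_zero order_antisym)
qed

lemma linear_ode_unique:
  fixes x y :: "real \<Rightarrow> 'a::real_inner"
  assumes f: "bounded_linear f"
    and x: "\<And>\<tau>. (x has_vector_derivative f (x \<tau>)) (at \<tau>)"
    and y: "\<And>\<tau>. (y has_vector_derivative f (y \<tau>)) (at \<tau>)"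
    and "x 0 = y 0"
  shows "x t = y t"
proof -
  define d where "d \<tau> = x \<tau> - y \<tau>" for \<tau>
  have d: "(d has_vector_derivative f (d \<tau>)) (at \<tau>)" for \<tau>
    unfolding d_def using has_vector_derivative_diff [OF x y]
    by (simp add: linear_diff [OF bounded_linear.linear [OF f]])
  have d0: "d 0 = 0" using assms by (simp add: d_def)
  have "d t = 0"
  proof (cases "t \<ge> 0")
    case True
    with f d d0 show ?thesis by (rule linear_ode_zero_forward)
  next
    \<comment> \<open>For negative time the reversed curve solves the equation with
      \<open>- f\<close> in place of \<open>f\<close>, so the forward result applies to it at
      \<open>- t\<close>.\<close>
    case False
    have "((\<lambda>\<tau>. d (- \<tau>)) has_vector_derivative - f (d (- \<tau>))) (at \<tau>)" for \<tau>
    proof -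
      have "(uminus has_vector_derivative - 1) (at \<tau>)"
        by (intro derivative_eq_intros) auto
      from vector_diff_chain_at [OF this d] show ?thesis by (simp add: o_def)
    qed
    then have "d (- (- t)) = 0"
      using False d0 bounded_linear_minus [OF f]
      by (intro linear_ode_zero_forward [of "\<lambda>x. - f x" "\<lambda>\<tau>. d (- \<tau>)" "- t"]) auto
    then show ?thesis by simp
  qed
  then show ?thesis by (simp add: d_def)
qed

text \<open>Existence and uniqueness in one statement. It lets a closed form be recognized as the
  flow by checking its derivative and initial value.\<close>

lemma solves_linear_ivp_iff: "solves_linear_ivp A x0 x \<longleftrightarrow> x = (\<lambda>t. linear_flow A t x0)"
proof
  assume "solves_linear_ivp A x0 x"
  then have "x 0 = linear_flow A 0 x0" "\<And>\<tau>. (x has_vector_derivative A *v x \<tau>) (at \<tau>)"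
    by (simp_all add: solves_linear_ivp_def linear_flow_0)
  then have "x t = linear_flow A t x0" for t
    by (rule linear_ode_unique [where f = "(*v) A", OF matrix_vector_mul_bounded_linear _
          linear_flow_has_vector_derivative, rotated])
  then show "x = (\<lambda>t. linear_flow A t x0)" by (rule ext)
next
  assume "x = (\<lambda>t. linear_flow A t x0)"
  then show "solves_linear_ivp A x0 x"
    using linear_flow_0 linear_flow_has_vector_derivative by (simp only: solves_linear_ivp_def) blast
qed

section \<open>The flow along one Jordan chain\<close>

text \<open>The right-hand side is \<open>exp (l * t)\<close> times the exponential series of the
  nilpotent shift down the chain. It stops at \<open>j < k\<close>, so only indices from 1 to
  \<open>k\<close> occur and \<open>u 0\<close>, which is arbitrary, never enters.\<close>

lemma linear_flow_jordan_chain: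
  fixes u :: "nat \<Rightarrow> complex ^ 'n"
  assumes chain_1: "A *v u 1 = l *s u 1"
    and chain_step: "\<And>i. i \<in> {2..m} \<Longrightarrow> A *v u i = l *s u i + u (i - 1)"
    and k: "k \<in> {1..m}"
  shows "linear_flow A t (u k) = (\<Sum>j<k. (of_real t ^ j / fact j * exp (l * of_real t)) *s u (k - j))"
proof -
  obtain n where n: "k = Suc n" using k by (cases k) auto
  \<comment> \<open>The coefficients are taken over complex \<open>z\<close> so that field
    derivatives apply; real time is substituted afterwards.\<close>
  define a where "a j z = z ^ j / fact j * exp (l * z)" for j and z :: complex
  define g where "g \<tau> = (\<Sum>j<k. a j (of_real \<tau>) *s u (k - j))" for \<tau> :: real
  have a_0: "(a 0 has_field_derivative l * a 0 z) (at z)" for z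
    unfolding a_def by (auto intro!: derivative_eq_intros)
  have a_Suc: "(a (Suc j) has_field_derivative l * a (Suc j) z + a j z) (at z)" for j z
  proof -
    have "((\<lambda>z. z ^ Suc j / fact (Suc j)) has_field_derivative z ^ j / fact j) (at z)"
      by (rule DERIV_cong [OF DERIV_cdivide [OF DERIV_power_Suc [OF DERIV_ident]]])
        (simp add: divide_simps del: of_nat_Suc, simp add: algebra_simps)
    moreover have "((\<lambda>z. exp (l * z)) has_field_derivative l * exp (l * z)) (at z)"
      by (auto intro!: derivative_eq_intros)
    ultimately have "((\<lambda>z. z ^ Suc j / fact (Suc j) * exp (l * z)) has_field_derivative
        z ^ j / fact j * exp (l * z) + l * exp (l * z) * (z ^ Suc j / fact (Suc j))) (at z)"
      by (rule DERIV_mult)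
    then show ?thesis unfolding a_def by (simp only: ac_simps)
  qed
  \<comment> \<open>This is the derivative of \<open>a j\<close>: the power of time contributes
    \<open>a (j - 1)\<close>, and nothing when \<open>j = 0\<close>.\<close>
  define a' where "a' j z = l * a j z + (case j of 0 \<Rightarrow> 0 | Suc i \<Rightarrow> a i z)" for j z
  have a': "((\<lambda>\<tau>. a j (of_real \<tau>)) has_vector_derivative a' j (of_real \<tau>)) (at \<tau>)" for j \<tau>
    using a_0 a_Suc by (intro has_vector_derivative_real_field) (auto simp: a'_def split: nat.split)
  have blin: "bounded_linear (\<lambda>c. c *s y)" for y :: "complex ^ 'n"
    by (auto simp flip: linear_conv_bounded_linear intro!: linearI simp: vector_sadd_rdistrib vec_eq_iff)
  have "(g has_vector_derivative A *v g \<tau>) (at \<tau>)" for \<tau>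
  proof -
    let ?a = "\<lambda>j. a j (of_real \<tau>)"
    have "(g has_vector_derivative (\<Sum>j<k. a' j (of_real \<tau>) *s u (k - j))) (at \<tau>)"
      unfolding g_def
      by (intro has_vector_derivative_sum bounded_linear.has_vector_derivative [OF blin] a')
    also have "(\<Sum>j<k. a' j (of_real \<tau>) *s u (k - j)) = l *s g \<tau> + (\<Sum>j<n. ?a j *s u (n - j))"
    proof -
      have "(\<Sum>j<k. a' j (of_real \<tau>) *s u (k - j)) = (\<Sum>j<k. l *s (?a j *s u (k - j)))
          + (\<Sum>j<k. (case j of 0 \<Rightarrow> 0 | Suc i \<Rightarrow> ?a i) *s u (k - j))"
        by (simp only: a'_def vector_sadd_rdistrib vector_smult_assoc sum.distrib)
      also have "(\<Sum>j<k. (case j of 0 \<Rightarrow> 0 | Suc i \<Rightarrow> ?a i) *s u (k - j)) = (\<Sum>j<n. ?a j *s u (n - j))"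
        by (simp add: n sum.lessThan_Suc_shift del: sum.lessThan_Suc)
      finally show ?thesis by (simp only: g_def vec.scale_sum_right)
    qed
    also have "\<dots> = A *v g \<tau>"
    proof -
      \<comment> \<open>At \<open>j = n\<close> the index \<open>k - j\<close> is 1, the bottom of
        the chain, so the lower neighbour is replaced by 0. For smaller \<open>j\<close> it is
        \<open>u (n - j)\<close>.\<close>
      have top: "A *v u (k - j) = l *s u (k - j) + (if j = n then 0 else u (n - j))" if "j < k" for j
      proof (cases "j = n")
        case True
        then show ?thesis using n chain_1 by simp
      next
        case False
        with that n k have "k - j \<in> {2..m}" "k - j - 1 = n - j" by auto
        with chain_step [of "k - j"] False show ?thesis by simp
      qed
      have "A *v g \<tau> = (\<Sum>j<k. ?a j *s (A *v u (k - j)))"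
        by (simp only: g_def vec.linear_sum [OF matrix_vector_mul_linear_gen] vector_scalar_commute)
      also have "\<dots> = (\<Sum>j<k. l *s (?a j *s u (k - j)) + ?a j *s (if j = n then 0 else u (n - j)))"
        by (intro sum.cong refl)
          (simp only: top lessThan_iff vector_add_ldistrib vector_smult_assoc mult.commute [of l])
      also have "\<dots> = l *s g \<tau> + (\<Sum>j<k. ?a j *s (if j = n then 0 else u (n - j)))"
        by (simp only: g_def vec.scale_sum_right sum.distrib)
      also have "(\<Sum>j<k. ?a j *s (if j = n then 0 else u (n - j))) = (\<Sum>j<n. ?a j *s u (n - j))"
        by (simp add: n)
      finally show ?thesis by (rule sym)
    qed
    finally show ?thesis .
  qed
  moreover have "g 0 = u k"
    by (simp add: g_def a_def n sum.lessThan_Suc_shift del: sum.lessThan_Suc)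
  ultimately have "solves_linear_ivp A (u k) g"
    unfolding solves_linear_ivp_def by blast
  then have "g t = linear_flow A t (u k)"
    by (simp only: solves_linear_ivp_iff)
  then show ?thesis by (simp add: g_def a_def)
qed

section \<open>Expansion in the Jordan basis and assembly of the formula\<close>

lemma span_jordan_basis:
  fixes A :: "'a::alg_closed_field ^ 'n ^ 'n"
  assumes eigenvalues: "lam ` H = {l. eigenvalue A l}"
    and basis: "\<And>h. h \<in> H \<Longrightarrow> basis_family (v h) (I h) (gen_eigenspace A (lam h))"
  shows "vec.span (\<Union>h\<in>H. v h ` I h) = UNIV"
proof -
  let ?V = "vec.span (\<Union>h\<in>H. v h ` I h)"
  have "gen_eigenspace A l \<subseteq> ?V" for l
  proof (cases "eigenvalue A l")
    case True
    with eigenvalues obtain h where h: "h \<in> H" "l = lam h" by blast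
    with basis have "gen_eigenspace A l = vec.span (v h ` I h)"
      by (simp add: basis_family_def)
    also have "\<dots> \<subseteq> ?V" using h by (intro vec.span_mono) blast
    finally show ?thesis .
  qed (simp add: gen_eigenspace_trivial vec.span_zero)
  then have "vec.span (\<Union>l. gen_eigenspace A l) \<subseteq> ?V"
    by (intro vec.span_minimal vec.subspace_span) blast
  then show ?thesis by (auto simp: span_gen_eigenspaces)
qed

text \<open>The right-hand side is linear in \<open>x\<close>, because the Hermitian product is
  linear in its first argument, and duality makes it fix every \<open>v h i\<close>. It is therefore
  the identity on their span.\<close>

lemma dual_basis_expansion:
  fixes v w :: "'h \<Rightarrow> 'i \<Rightarrow> complex ^ 'n"
  assumes "finite H" and "\<And>h. h \<in> H \<Longrightarrow> finite (I h)"
    and span: "vec.span (\<Union>h\<in>H. v h ` I h) = UNIV"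
    and dual: "\<And>h k i j. h \<in> H \<Longrightarrow> k \<in> H \<Longrightarrow> i \<in> I h \<Longrightarrow> j \<in> I k \<Longrightarrow>
      hermitian_inner (v h i) (w k j) = (if h = k \<and> i = j then 1 else 0)"
  shows "x = (\<Sum>h\<in>H. \<Sum>k\<in>I h. hermitian_inner x (w h k) *s v h k)"
proof -
  define P where "P x = (\<Sum>h\<in>H. \<Sum>k\<in>I h. hermitian_inner x (w h k) *s v h k)" for x
  have add: "P (x + y) = P x + P y" for x y
    by (simp add: P_def hermitian_inner_def distrib_right sum.distrib vector_sadd_rdistrib)
  have scale: "P (c *s x) = c *s P x" for c x
  proof -
    have "hermitian_inner (c *s x) y = c * hermitian_inner x y" for y
      by (simp add: hermitian_inner_def sum_distrib_left mult.assoc)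
    then show ?thesis by (simp add: P_def vec.scale_sum_right vector_smult_assoc)
  qed
  have P_basis: "P (v h i) = v h i" if "h \<in> H" "i \<in> I h" for h i
  proof -
    have "P (v h i) = (\<Sum>k\<in>H. \<Sum>j\<in>I k. if h = k \<and> i = j then v k j else 0)"
      unfolding P_def using dual that by (intro sum.cong refl) auto
    also have "\<dots> = (\<Sum>k\<in>H. if k = h then v h i else 0)"
      using assms(2) that by (intro sum.cong refl) auto
    also have "\<dots> = v h i" using \<open>finite H\<close> that by simp
    finally show ?thesis .
  qed
  have "x \<in> vec.span (\<Union>h\<in>H. v h ` I h)" by (simp add: span)
  then have "P x = x"
  proof (induction rule: vec.span_induct_alt)
    case base
    show ?case using scale [of 0 0] by simp
  next
    case (step c z y)
    then have "P z = z" using P_basis by blast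
    with step show ?case by (simp add: add scale)
  qed
  then show ?thesis by (simp add: P_def)
qed

text \<open>Both sides sum over the triangle 0 <= i < k <= m, by rows and by columns, with the
  column i = 0 split off. For m = 0 every sum is empty.\<close>

lemma sum_triangle_swap:
  fixes f :: "nat \<Rightarrow> nat \<Rightarrow> 'a::comm_monoid_add"
  shows "(\<Sum>k=1..m. \<Sum>i<k. f k i) = (\<Sum>k=1..m. f k 0) + (\<Sum>i=1..m - 1. \<Sum>k=i+1..m. f k i)"
proof -
  have "(\<Sum>k=1..m. \<Sum>i<k. f k i) = (\<Sum>k=1..m. f k 0 + (\<Sum>i=1..<k. f k i))"
    by (intro sum.cong refl) (simp add: lessThan_atLeast0 sum.atLeast_Suc_lessThan)
  also have "\<dots> = (\<Sum>k=1..m. f k 0) + (\<Sum>k=1..m. \<Sum>i=1..<k. f k i)"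
    by (rule sum.distrib)
  also have "(\<Sum>k=1..m. \<Sum>i=1..<k. f k i) = (\<Sum>i=1..m - 1. \<Sum>k=i+1..m. f k i)"
    unfolding sum.Sigma [OF finite_atLeastAtMost ballI [OF finite_atLeastLessThan]]
      sum.Sigma [OF finite_atLeastAtMost ballI [OF finite_atLeastAtMost]]
    by (rule sum.reindex_bij_witness [of _ prod.swap prod.swap]) auto
  finally show ?thesis .
qed

theorem mainTheorem1:
  fixes A :: "complex ^ 'n ^ 'n"
    and s :: nat
    and lam :: "nat \<Rightarrow> complex"
    and m :: "nat \<Rightarrow> nat"
    and v w :: "nat \<Rightarrow> nat \<Rightarrow> complex ^ 'n"
    and \<phi> :: "nat \<Rightarrow> nat \<Rightarrow> complex ^ 'n \<Rightarrow> complex"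
    and x0 :: "complex ^ 'n"
    and t :: real
  assumes geom_dim: "\<And>l. eigenvalue A l \<Longrightarrow> vec.dim (eigenspace A l) = 1"
    and distinct: "inj_on lam {1..s}"
    and eigenvalues: "lam ` {1..s} = {l. eigenvalue A l}"
    and mult: "\<And>h. h \<in> {1..s} \<Longrightarrow> m h = alg_mult A (lam h)"
    and basis: "\<And>h. h \<in> {1..s} \<Longrightarrow>
      basis_family (v h) {1..m h} (gen_eigenspace A (lam h))"
    and chain_1: "\<And>h. h \<in> {1..s} \<Longrightarrow> A *v v h 1 = lam h *s v h 1"
    and chain_step: "\<And>h i. h \<in> {1..s} \<Longrightarrow> i \<in> {2..m h} \<Longrightarrow>
      A *v v h i = lam h *s v h i + v h (i - 1)"
    and dual: "\<And>h k i j. h \<in> {1..s} \<Longrightarrow> k \<in> {1..s} \<Longrightarrow> i \<in> {1..m h} \<Longrightarrow> j \<in> {1..m k} \<Longrightarrow>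
      hermitian_inner (v h i) (w k j) = (if h = k \<and> i = j then 1 else 0)"
    and phi: "\<And>h i x. h \<in> {1..s} \<Longrightarrow> i \<in> {1..m h} \<Longrightarrow> \<phi> h i x = hermitian_inner x (w h i)"
  shows "(\<forall>x. solves_linear_ivp A x0 x \<longleftrightarrow>
            x = (\<lambda>\<tau>. koopman (linear_flow A) \<tau> (\<lambda>y. y) x0)) \<and>
         koopman (linear_flow A) t (\<lambda>y. y) x0 = matrix_exp (t *\<^sub>R A) *v x0 \<and>
         koopman (linear_flow A) t (\<lambda>y. y) x0 =
           (\<Sum>h=1..s.
              exp (lam h * of_real t) *s (\<Sum>k=1..m h. \<phi> h k x0 *s v h k)
              + (\<Sum>i=1..m h - 1.
                   (of_real t ^ i / fact i * exp (lam h * of_real t)) *s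
                     (\<Sum>k=i+1..m h. \<phi> h k x0 *s v h (k - i))))"
proof -
  let ?e = "\<lambda>h. exp (lam h * of_real t)"
  let ?c = "\<lambda>h i. of_real t ^ i / fact i * ?e h"
  have "vec.span (\<Union>h\<in>{1..s}. v h ` {1..m h}) = UNIV"
    using eigenvalues basis
    by (rule span_jordan_basis [where I = "\<lambda>h. {1..m h}" and v = v])
  \<comment> \<open>The eigenfunctions are the coordinates in the Jordan basis, so by linearity the
    flow need only be known on the basis vectors.\<close>
  then have "x0 = (\<Sum>h=1..s. \<Sum>k=1..m h. hermitian_inner x0 (w h k) *s v h k)"
    using dual by (intro dual_basis_expansion) auto
  also have "\<dots> = (\<Sum>h=1..s. \<Sum>k=1..m h. \<phi> h k x0 *s v h k)"
    using phi by (intro sum.cong refl) simp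
  finally have "linear_flow A t x0
      = linear_flow A t (\<Sum>h=1..s. \<Sum>k=1..m h. \<phi> h k x0 *s v h k)" by simp
  also have "\<dots> = (\<Sum>h=1..s. \<Sum>k=1..m h. \<phi> h k x0 *s linear_flow A t (v h k))"
    by (simp add: linear_flow_def vec.linear_sum [OF matrix_vector_mul_linear_gen] vector_scalar_commute)
  also have "\<dots> = (\<Sum>h=1..s. ?e h *s (\<Sum>k=1..m h. \<phi> h k x0 *s v h k)
      + (\<Sum>i=1..m h - 1. ?c h i *s (\<Sum>k=i+1..m h. \<phi> h k x0 *s v h (k - i))))"
  proof (rule sum.cong [OF refl])
    fix h assume h: "h \<in> {1..s}"
    \<comment> \<open>Within one chain the closed form gives a double sum over i < k. Regrouping by
      powers of time turns the column i = 0 into the purely exponential term.\<close>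
    have "(\<Sum>k=1..m h. \<phi> h k x0 *s linear_flow A t (v h k))
        = (\<Sum>k=1..m h. \<Sum>i<k. ?c h i *s (\<phi> h k x0 *s v h (k - i)))"
    proof (rule sum.cong [OF refl])
      fix k assume "k \<in> {1..m h}"
      with chain_1 [OF h] chain_step [OF h]
      have "linear_flow A t (v h k) = (\<Sum>i<k. ?c h i *s v h (k - i))"
        by (rule linear_flow_jordan_chain)
      then show "\<phi> h k x0 *s linear_flow A t (v h k) = (\<Sum>i<k. ?c h i *s (\<phi> h k x0 *s v h (k - i)))"
        by (simp add: vec.scale_sum_right vector_smult_assoc mult_ac)
    qed
    also have "\<dots> = ?e h *s (\<Sum>k=1..m h. \<phi> h k x0 *s v h k)
        + (\<Sum>i=1..m h - 1. ?c h i *s (\<Sum>k=i+1..m h. \<phi> h k x0 *s v h (k - i)))"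
      unfolding sum_triangle_swap by (simp add: vec.scale_sum_right)
    finally show "(\<Sum>k=1..m h. \<phi> h k x0 *s linear_flow A t (v h k))
        = ?e h *s (\<Sum>k=1..m h. \<phi> h k x0 *s v h k)
          + (\<Sum>i=1..m h - 1. ?c h i *s (\<Sum>k=i+1..m h. \<phi> h k x0 *s v h (k - i)))" .
  qed
  finally have "koopman (linear_flow A) t (\<lambda>y. y) x0 = (\<Sum>h=1..s.
      ?e h *s (\<Sum>k=1..m h. \<phi> h k x0 *s v h k)
      + (\<Sum>i=1..m h - 1. ?c h i *s (\<Sum>k=i+1..m h. \<phi> h k x0 *s v h (k - i))))"
    by (simp add: koopman_def)
  moreover have "\<forall>x. solves_linear_ivp A x0 x \<longleftrightarrow> x = (\<lambda>\<tau>. koopman (linear_flow A) \<tau> (\<lambda>y. y) x0)"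
    by (simp add: solves_linear_ivp_iff koopman_def)
  moreover have "koopman (linear_flow A) t (\<lambda>y. y) x0 = matrix_exp (t *\<^sub>R A) *v x0"
    by (simp add: koopman_def linear_flow_def)
  ultimately show ?thesis by blast
qed

end
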